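(* Let $K$ be a field of characteristic $0$, let $U_1$ be the associative unital $K$-algebra generated by $l_1,r_1$ with the single defining relation $r_1l_1=l_1r_1+r_1^2$, and let $R_1=K[r_1]\subseteq U_1$ be the subalgebra generated by $r_1$. If $D$ is a locally nilpotent derivation of $U_1$, then $D(l_1)\in R_1$ and $D(r_1)=0$.
   Context: A derivation is a $K$-linear map $D:U_1\to U_1$ with $D(xy)=D(x)y+xD(y)$; it is locally nilpotent if for every $a\in U_1$ there is a natural number $m$ with $D^m(a)=0$. *)

theory Defs
  imports Complex_Main "HOL-Library.Poly_Mapping"
begin

datatype 'g free_monoid = Word (letters: "'g list")

text \<open>The free monoid is written additively because the type of finitely supported functions
  carries its convolution product for exponents in an additive, not necessarily commutative,
  monoid.\<close>

instantiation free_monoid :: (type) monoid_add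
begin

definition zero_free_monoid :: "'a free_monoid" where
  "0 = Word []"

definition plus_free_monoid :: "'a free_monoid \<Rightarrow> 'a free_monoid \<Rightarrow> 'a free_monoid" where
  "u + v = Word (letters u @ letters v)"

instance
  by standard (simp_all add: zero_free_monoid_def plus_free_monoid_def)

end

lemma free_monoid_add_eq_0_iff: "u + v = 0 \<longleftrightarrow> u = 0 \<and> v = (0 :: 'g free_monoid)"
  by (cases u; cases v) (auto simp: zero_free_monoid_def plus_free_monoid_def)

type_synonym ('g, 'k) free_algebra = "'g free_monoid \<Rightarrow>\<^sub>0 'k"

definition free_gen :: "'g \<Rightarrow> ('g, 'k::field) free_algebra" where
  "free_gen g = Poly_Mapping.single (Word [g]) 1"

definition free_scalar :: "'k \<Rightarrow> ('g, 'k::field) free_algebra" where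
  "free_scalar c = Poly_Mapping.single 0 c"

lemma free_scalar_0 [simp]: "free_scalar 0 = 0"
  and free_scalar_1 [simp]: "free_scalar 1 = 1"
  and free_scalar_add: "free_scalar (c + d) = free_scalar c + free_scalar d"
  and free_scalar_mult: "free_scalar (c * d) = free_scalar c * free_scalar d"
  by (simp_all add: free_scalar_def single_add mult_single)

lemma free_algebra_induct [case_names single sum]:
  fixes x :: "'a \<Rightarrow>\<^sub>0 'b::monoid_add"
  assumes single: "\<And>u c. P (Poly_Mapping.single u c)"
    and sum: "\<And>f g. P f \<Longrightarrow> P g \<Longrightarrow> P (f + g)"
  shows "P x"
proof (induction x rule: update_induct)
  case const
  then show ?case using single[of undefined 0] by simp
next
  case (update f u c)
  then have "Poly_Mapping.update u c f = f + Poly_Mapping.single u c"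
    by (intro poly_mapping_eqI)
      (auto simp: lookup_update lookup_add lookup_single when_def in_keys_iff)
  then show ?case using sum[OF update.IH single] by simp
qed

lemma free_scalar_central: "free_scalar c * x = x * free_scalar c"
proof (induction x rule: free_algebra_induct)
  case (single u d)
  then show ?case by (simp add: free_scalar_def mult_single mult.commute)
next
  case (sum f g)
  then show ?case by (simp add: algebra_simps)
qed

definition two_sided_ideal :: "'a::ring_1 set \<Rightarrow> bool" where
  "two_sided_ideal I \<longleftrightarrow>
     0 \<in> I \<and> (\<forall>x\<in>I. \<forall>y\<in>I. x + y \<in> I) \<and> (\<forall>x\<in>I. \<forall>a. a * x \<in> I \<and> x * a \<in> I)"

lemma two_sided_ideal_hull: "two_sided_ideal (two_sided_ideal hull S)"
  by (rule hull_in) (auto simp: two_sided_ideal_def)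

lemma two_sided_ideal_0: "two_sided_ideal I \<Longrightarrow> 0 \<in> I"
  and two_sided_ideal_add: "two_sided_ideal I \<Longrightarrow> x \<in> I \<Longrightarrow> y \<in> I \<Longrightarrow> x + y \<in> I"
  and two_sided_ideal_lmult: "two_sided_ideal I \<Longrightarrow> x \<in> I \<Longrightarrow> a * x \<in> I"
  and two_sided_ideal_rmult: "two_sided_ideal I \<Longrightarrow> x \<in> I \<Longrightarrow> x * a \<in> I"
  by (auto simp: two_sided_ideal_def)

lemma two_sided_ideal_uminus: "two_sided_ideal I \<Longrightarrow> x \<in> I \<Longrightarrow> - x \<in> I"
  using two_sided_ideal_lmult[of I x "- 1"] by simp

datatype gen = GenL | GenR

definition U1_relator :: "(gen, 'k::field) free_algebra" where
  "U1_relator =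
     free_gen GenR * free_gen GenL - (free_gen GenL * free_gen GenR + free_gen GenR ^ 2)"

definition U1_ideal :: "(gen, 'k::field) free_algebra set" where
  "U1_ideal = two_sided_ideal hull {U1_relator}"

definition U1_rel :: "(gen, 'k::field) free_algebra \<Rightarrow> (gen, 'k) free_algebra \<Rightarrow> bool" where
  "U1_rel x y \<longleftrightarrow> x - y \<in> U1_ideal"

lemma two_sided_ideal_U1_ideal: "two_sided_ideal U1_ideal"
  unfolding U1_ideal_def by (rule two_sided_ideal_hull)

lemmas U1_ideal_closed =
  two_sided_ideal_0[OF two_sided_ideal_U1_ideal]
  two_sided_ideal_add[OF two_sided_ideal_U1_ideal]
  two_sided_ideal_uminus[OF two_sided_ideal_U1_ideal]
  two_sided_ideal_lmult[OF two_sided_ideal_U1_ideal]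
  two_sided_ideal_rmult[OF two_sided_ideal_U1_ideal]

lemma U1_relator_in_ideal: "U1_relator \<in> U1_ideal"
  unfolding U1_ideal_def by (rule hull_inc) simp

lemma equivp_U1_rel:
  "equivp (U1_rel :: (gen, 'k::field) free_algebra \<Rightarrow> (gen, 'k) free_algebra \<Rightarrow> bool)"
  (is "equivp ?R")
proof (rule equivpI)
  show "reflp ?R"
    by (rule reflpI) (simp add: U1_rel_def U1_ideal_closed)
  show "symp ?R"
  proof (rule sympI)
    fix x y :: "(gen, 'k) free_algebra"
    assume "U1_rel x y"
    then show "U1_rel y x"
      unfolding U1_rel_def by (metis U1_ideal_closed(3) minus_diff_eq)
  qed
  show "transp ?R"
  proof (rule transpI)
    fix x y z :: "(gen, 'k) free_algebra"
    assume "U1_rel x y" "U1_rel y z"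
    then show "U1_rel x z"
      using U1_ideal_closed(2)[of "x - y" "y - z"] by (simp add: U1_rel_def)
  qed
qed

lemma lookup_mult_0:
  fixes x y :: "('g, 'k::field) free_algebra"
  shows "Poly_Mapping.lookup (x * y) 0 = Poly_Mapping.lookup x 0 * Poly_Mapping.lookup y 0"
proof (induction x rule: free_algebra_induct)
  case (single u c)
  show ?case
  proof (induction y rule: free_algebra_induct)
    case (single v d)
    show ?case
      by (auto simp: mult_single lookup_single when_def free_monoid_add_eq_0_iff)
  next
    case (sum f g)
    then show ?case by (simp add: algebra_simps lookup_add)
  qed
next
  case (sum f g)
  then show ?case by (simp add: algebra_simps lookup_add)
qed

lemma one_notin_U1_ideal: "1 \<notin> (U1_ideal :: (gen, 'k::field) free_algebra set)"
proof -
  let ?J = "{x :: (gen, 'k) free_algebra. Poly_Mapping.lookup x 0 = 0}"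
  have "two_sided_ideal ?J"
    by (auto simp: two_sided_ideal_def lookup_add lookup_mult_0)
  moreover have "Poly_Mapping.lookup (free_gen g :: (gen, 'k) free_algebra) 0 = 0" for g
    by (simp add: free_gen_def lookup_single zero_free_monoid_def)
  then have "U1_relator \<in> ?J"
    by (simp add: U1_relator_def lookup_minus lookup_add lookup_mult_0 power2_eq_square)
  ultimately have "U1_ideal \<subseteq> ?J"
    unfolding U1_ideal_def by (intro hull_minimal) auto
  then show ?thesis
    by (auto simp: lookup_one)
qed

quotient_type (overloaded) 'k U1 = "(gen, 'k::field) free_algebra" / U1_rel
  by (rule equivp_U1_rel)

instantiation U1 :: (field) ring_1
begin

lift_definition zero_U1 :: "'a U1" is 0 .

lift_definition one_U1 :: "'a U1" is 1 .

lift_definition plus_U1 :: "'a U1 \<Rightarrow> 'a U1 \<Rightarrow> 'a U1" is "(+)"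
proof -
  fix x x' y y' :: "(gen, 'a) free_algebra"
  assume "U1_rel x x'" "U1_rel y y'"
  moreover have "x + y - (x' + y') = (x - x') + (y - y')" by (rule add_diff_add)
  ultimately show "U1_rel (x + y) (x' + y')"
    unfolding U1_rel_def by (metis U1_ideal_closed(2))
qed

lift_definition uminus_U1 :: "'a U1 \<Rightarrow> 'a U1" is uminus
proof -
  fix x x' :: "(gen, 'a) free_algebra"
  assume "U1_rel x x'"
  moreover have "- x - (- x') = - (x - x')" by simp
  ultimately show "U1_rel (- x) (- x')"
    unfolding U1_rel_def by (metis U1_ideal_closed(3))
qed

lift_definition minus_U1 :: "'a U1 \<Rightarrow> 'a U1 \<Rightarrow> 'a U1" is "(-)"
proof -
  fix x x' y y' :: "(gen, 'a) free_algebra"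
  assume "U1_rel x x'" "U1_rel y y'"
  moreover have "x - y - (x' - y') = (x - x') + - (y - y')" by simp
  ultimately show "U1_rel (x - y) (x' - y')"
    unfolding U1_rel_def by (metis U1_ideal_closed(2,3))
qed

lift_definition times_U1 :: "'a U1 \<Rightarrow> 'a U1 \<Rightarrow> 'a U1" is "(*)"
proof -
  fix x x' y y' :: "(gen, 'a) free_algebra"
  assume "U1_rel x x'" "U1_rel y y'"
  moreover have "x * y - x' * y' = (x - x') * y + x' * (y - y')"
    by (simp add: algebra_simps)
  ultimately show "U1_rel (x * y) (x' * y')"
    unfolding U1_rel_def by (metis U1_ideal_closed(2,4,5))
qed

instance
proof
  fix a b c :: "'a U1"
  have eqI: "U1_rel x y" if "x = y" for x y :: "(gen, 'a) free_algebra"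
    using that by (simp add: U1_rel_def U1_ideal_closed)
  show "a + b + c = a + (b + c)" by transfer (rule eqI, simp add: algebra_simps)
  show "a + b = b + a" by transfer (rule eqI, simp add: algebra_simps)
  show "0 + a = a" by transfer (rule eqI, simp)
  show "- a + a = 0" by transfer (rule eqI, simp)
  show "a - b = a + - b" by transfer (rule eqI, simp)
  show "a * b * c = a * (b * c)" by transfer (rule eqI, simp add: algebra_simps)
  show "(a + b) * c = a * c + b * c" by transfer (rule eqI, simp add: algebra_simps)
  show "a * (b + c) = a * b + a * c" by transfer (rule eqI, simp add: algebra_simps)
  show "1 * a = a" by transfer (rule eqI, simp)
  show "a * 1 = a" by transfer (rule eqI, simp)
  show "(0 :: 'a U1) \<noteq> 1"
  proof transfer
    show "\<not> U1_rel 0 (1 :: (gen, 'a) free_algebra)"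
      using one_notin_U1_ideal U1_ideal_closed(3)[of "- 1"] by (auto simp: U1_rel_def)
  qed
qed

end

lift_definition l1 :: "'k::field U1" is "free_gen GenL" .

lift_definition r1 :: "'k::field U1" is "free_gen GenR" .

lift_definition scale_U1 :: "'k::field \<Rightarrow> 'k U1 \<Rightarrow> 'k U1" is "\<lambda>c x. free_scalar c * x"
proof -
  fix c :: 'k and x x' :: "(gen, 'k) free_algebra"
  assume "U1_rel x x'"
  then show "U1_rel (free_scalar c * x) (free_scalar c * x')"
    using U1_ideal_closed(4)[of "x - x'" "free_scalar c"]
    by (simp add: U1_rel_def right_diff_distrib)
qed

lemma U1_relation: "r1 * l1 = l1 * r1 + (r1 :: 'k::field U1) ^ 2"
  unfolding power2_eq_square
  by transfer (use U1_relator_in_ideal in \<open>simp add: U1_rel_def U1_relator_def power2_eq_square\<close>)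

lemma vector_space_scale_U1: "vector_space (scale_U1 :: 'k::field \<Rightarrow> 'k U1 \<Rightarrow> 'k U1)"
proof
  fix a b :: 'k and x y :: "'k U1"
  have eqI: "U1_rel u v" if "u = v" for u v :: "(gen, 'k) free_algebra"
    using that by (simp add: U1_rel_def U1_ideal_closed)
  show "scale_U1 a (x + y) = scale_U1 a x + scale_U1 a y"
    by transfer (rule eqI, simp add: algebra_simps)
  show "scale_U1 (a + b) x = scale_U1 a x + scale_U1 b x"
    by transfer (rule eqI, simp add: algebra_simps free_scalar_add)
  show "scale_U1 a (scale_U1 b x) = scale_U1 (a * b) x"
    by transfer (rule eqI, simp add: free_scalar_mult mult.assoc)
  show "scale_U1 1 x = x"
    by transfer (rule eqI, simp)
qed

lemma scale_U1_mult_left: "scale_U1 c x * y = scale_U1 c (x * y)"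
  by transfer (simp add: U1_rel_def U1_ideal_closed mult.assoc)

lemma scale_U1_mult_right: "x * scale_U1 c y = scale_U1 c (x * y)"
proof transfer
  fix x y :: "(gen, 'a) free_algebra" and c
  have "x * (free_scalar c * y) = free_scalar c * (x * y)"
    by (metis free_scalar_central mult.assoc)
  then show "U1_rel (x * (free_scalar c * y)) (free_scalar c * (x * y))"
    by (simp add: U1_rel_def U1_ideal_closed)
qed

definition subalgebra_U1 :: "'k::field U1 set \<Rightarrow> bool" where
  "subalgebra_U1 A \<longleftrightarrow>
     module.subspace scale_U1 A \<and> 1 \<in> A \<and> (\<forall>x\<in>A. \<forall>y\<in>A. x * y \<in> A)"

definition R1 :: "'k::field U1 set" where
  "R1 = subalgebra_U1 hull {r1}"

definition derivation_U1 :: "('k::field U1 \<Rightarrow> 'k U1) \<Rightarrow> bool" where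
  "derivation_U1 D \<longleftrightarrow>
     Vector_Spaces.linear scale_U1 scale_U1 D \<and> (\<forall>x y. D (x * y) = D x * y + x * D y)"

definition locally_nilpotent :: "('a::zero \<Rightarrow> 'a) \<Rightarrow> bool" where
  "locally_nilpotent D \<longleftrightarrow> (\<forall>a. \<exists>m::nat. (D ^^ m) a = 0)"

end

theory Submission imports Defs "HOL-Computational_Algebra.Polynomial"
begin

text \<open>
  The algebra \<open>U1\<close> acts on \<open>K[l][r]\<close>, with \<open>r1\<close> acting as multiplication by \<open>r\<close> and \<open>l1\<close> as
  \<open>f \<mapsto> l f - r\<^sup>2 \<partial>f/\<partial>r\<close>. Evaluating at \<open>1\<close> shows that the ordered monomials \<open>r1\<^sup>i l1\<^sup>j\<close> form a basis;
  hence \<open>r1\<close> is regular and normal with quotient \<open>U1 / (r1) \<cong> K[l1]\<close>, and comparing lowest terms in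
  \<open>r1\<close> shows that \<open>U1\<close> is a domain.

  Commutators with \<open>l1\<close> or \<open>r1\<close> lie in \<open>r1\<^sup>2 U1\<close>. Applying a derivation \<open>D\<close> to the relation
  therefore gives \<open>2 r1 D r1 \<in> r1\<^sup>2 U1\<close>, that is \<open>D r1 \<in> r1 U1\<close>. In a domain of characteristic \<open>0\<close> the
  nilpotency order of a product is the sum of the orders of its factors, while \<open>D\<close> lowers the
  order, so a locally nilpotent \<open>D\<close> has \<open>D r1 = 0\<close>. Then the differentiated relation says that
  \<open>D l1\<close> commutes with \<open>r1\<close>; since \<open>[r1, u] \<in> r1\<^sup>2 (g' + r1 U1)\<close> when \<open>u \<in> g(l1) + r1 U1\<close>,
  the centralizer of \<open>r1\<close> is \<open>R1\<close>.
\<close>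

section \<open>The representation on polynomials\<close>

text \<open>The outer variable of \<open>poly poly\<close> is \<open>r\<close>, the inner one is \<open>l\<close>.\<close>

fun gen_act :: "gen \<Rightarrow> 'k::field poly poly \<Rightarrow> 'k poly poly" where
  "gen_act GenL f = smult [:0, 1:] f - pCons 0 (pCons 0 (pderiv f))"
| "gen_act GenR f = pCons 0 f"

lemma gen_act_0 [simp]: "gen_act g 0 = 0"
  and gen_act_add: "gen_act g (f + h) = gen_act g f + gen_act g h"
  and gen_act_smult: "gen_act g (smult [:c:] f) = smult [:c:] (gen_act g f)"
  by (cases g; simp add: pderiv_add pderiv_smult smult_add_right smult_diff_right)+

definition word_act :: "gen free_monoid \<Rightarrow> 'k::field poly poly \<Rightarrow> 'k poly poly" where
  "word_act w = foldr gen_act (letters w)"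

lemma word_act_0 [simp]: "word_act w 0 = 0"
  and word_act_add: "word_act w (f + h) = word_act w f + word_act w h"
  and word_act_smult: "word_act w (smult [:c:] f) = smult [:c:] (word_act w f)"
proof -
  have "foldr gen_act gs 0 = 0" for gs
    by (induction gs) simp_all
  then show "word_act w 0 = 0"
    by (simp add: word_act_def)
  have "foldr gen_act gs (f + h) = foldr gen_act gs f + foldr gen_act gs h"
    and "foldr gen_act gs (smult [:c:] f) = smult [:c:] (foldr gen_act gs f)" for gs
    by (induction gs) (simp_all only: foldr.simps id_apply comp_apply gen_act_add gen_act_smult)
  then show "word_act w (f + h) = word_act w f + word_act w h"
    "word_act w (smult [:c:] f) = smult [:c:] (word_act w f)"
    by (simp_all only: word_act_def)
qed

lemma word_act_plus: "word_act (v + w) f = word_act v (word_act w f)"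
  by (simp add: word_act_def plus_free_monoid_def)

definition free_act :: "(gen, 'k::field) free_algebra \<Rightarrow> 'k poly poly \<Rightarrow> 'k poly poly" where
  "free_act x f =
     (\<Sum>w\<in>Poly_Mapping.keys x. smult [:Poly_Mapping.lookup x w:] (word_act w f))"

lemma free_act_0 [simp]: "free_act 0 f = 0"
  by (simp add: free_act_def)

lemma free_act_single: "free_act (Poly_Mapping.single w c) f = smult [:c:] (word_act w f)"
  by (simp add: free_act_def)

lemma free_act_superset:
  assumes "finite A" "Poly_Mapping.keys x \<subseteq> A"
  shows "free_act x f = (\<Sum>w\<in>A. smult [:Poly_Mapping.lookup x w:] (word_act w f))"
  unfolding free_act_def using assms
  by (intro sum.mono_neutral_left) (auto simp: in_keys_iff)

lemma free_act_add: "free_act (x + y) f = free_act x f + free_act y f"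
proof -
  let ?A = "Poly_Mapping.keys x \<union> Poly_Mapping.keys y"
  have "free_act z f = (\<Sum>w\<in>?A. smult [:Poly_Mapping.lookup z w:] (word_act w f))"
    if "z \<in> {x, y, x + y}" for z
    using that Poly_Mapping.keys_add[of x y] by (intro free_act_superset) auto
  moreover have "[:c + d:] = [:c:] + [:d:]" for c d :: 'a
    by simp
  ultimately show ?thesis
    by (simp only: insertI1 insertI2 lookup_add smult_add_left sum.distrib)
qed

lemma free_act_diff: "free_act (x - y) f = free_act x f - free_act y f"
  using free_act_add[of "x - y" y f] by (simp add: algebra_simps)

lemma free_act_zero_right [simp]: "free_act x 0 = 0"
  by (simp add: free_act_def)

lemma free_act_add_right: "free_act x (f + h) = free_act x f + free_act x h"
  by (simp add: free_act_def word_act_add smult_add_right sum.distrib)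

lemma free_act_mult: "free_act (x * y) f = free_act x (free_act y f)"
proof (induction x rule: free_algebra_induct)
  case (single u c)
  show ?case
  proof (induction y rule: free_algebra_induct)
    case (single v d)
    show ?case by (simp add: mult_single free_act_single word_act_plus word_act_smult mult.commute)
  next
    case (sum y z)
    then show ?case by (simp add: algebra_simps free_act_add free_act_add_right)
  qed
next
  case (sum x z)
  then show ?case by (simp add: algebra_simps free_act_add)
qed

lemma free_act_gen: "free_act (free_gen g) f = gen_act g f"
  by (simp add: free_gen_def free_act_single word_act_def flip: one_pCons)

text \<open>The product rule for the derivative of \<open>r * f\<close> contributes exactly the term
  \<open>r^2 * f\<close> demanded by the relation.\<close>

lemma free_act_relator: "free_act U1_relator f = 0"
  by (simp add: U1_relator_def free_act_diff free_act_add free_act_mult free_act_gen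
      power2_eq_square pderiv_pCons smult_add_right)

lemma free_act_ideal:
  assumes "x \<in> U1_ideal"
  shows "free_act x f = 0"
proof -
  have "two_sided_ideal {x. \<forall>f. free_act x f = 0}"
    by (auto simp: two_sided_ideal_def free_act_add free_act_mult)
  then have "U1_ideal \<subseteq> {x. \<forall>f. free_act x f = 0}"
    unfolding U1_ideal_def by (intro hull_minimal) (auto simp: free_act_relator)
  with assms show ?thesis by auto
qed

lift_definition act :: "'k::field U1 \<Rightarrow> 'k poly poly \<Rightarrow> 'k poly poly" is free_act
  by (auto simp: U1_rel_def free_act_diff fun_eq_iff dest: free_act_ideal)

lemma act_0 [simp]: "act 0 f = 0"
  by transfer simp

lemma act_add: "act (u + v) f = act u f + act v f"
  by transfer (rule free_act_add)

lemma act_mult: "act (u * v) f = act u (act v f)"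
  by transfer (rule free_act_mult)

lemma act_r1: "act r1 f = pCons 0 f"
  by transfer (simp add: free_act_gen)

lemma act_l1: "act l1 f = smult [:0, 1:] f - pCons 0 (pCons 0 (pderiv f))"
  by transfer (simp add: free_act_gen)

lemma act_scale_1: "act (scale_U1 c 1) f = smult [:c:] f"
  by transfer (simp add: free_scalar_def free_act_single word_act_def zero_free_monoid_def)

section \<open>Normal forms in ordered monomials\<close>

interpretation U1: vector_space scale_U1
  by (rule vector_space_scale_U1)

lemma U1_induct [case_names scalar add l1 r1]:
  fixes u :: "'k::field U1"
  assumes scalar: "\<And>c. P (scale_U1 c 1)"
    and add: "\<And>u v. P u \<Longrightarrow> P v \<Longrightarrow> P (u + v)"
    and l1: "\<And>u. P u \<Longrightarrow> P (l1 * u)"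
    and r1: "\<And>u. P u \<Longrightarrow> P (r1 * u)"
  shows "P u"
proof -
  have "P (abs_U1 x)" for x
  proof (induction x rule: free_algebra_induct)
    case (single w c)
    have "P (abs_U1 (Poly_Mapping.single (Word gs) c))" for gs
    proof (induction gs)
      case Nil
      have "abs_U1 (Poly_Mapping.single (Word []) c) = scale_U1 c 1"
        by (simp add: one_U1_def scale_U1.abs_eq free_scalar_def zero_free_monoid_def mult_single)
      then show ?case using scalar by simp
    next
      case (Cons g gs)
      have "abs_U1 (Poly_Mapping.single (Word (g # gs)) c)
          = abs_U1 (free_gen g) * abs_U1 (Poly_Mapping.single (Word gs) c)"
        by (simp add: times_U1.abs_eq free_gen_def mult_single plus_free_monoid_def)
      then show ?case
        using l1[OF Cons] r1[OF Cons] by (cases g) (simp_all add: l1_def r1_def)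
    qed
    then show ?case by (cases w) simp
  next
    case (sum x y)
    then show ?case using add by (metis plus_U1.abs_eq)
  qed
  then show ?thesis by (metis U1.abs_induct)
qed

text \<open>The library function \<open>poly\<close> evaluates only at elements of commutative rings.\<close>

definition eval_l1 :: "'k::field poly \<Rightarrow> 'k U1" where
  "eval_l1 g = fold_coeffs (\<lambda>c u. scale_U1 c 1 + l1 * u) g 0"

lemma eval_l1_0 [simp]: "eval_l1 0 = 0"
  by (simp add: eval_l1_def)

lemma eval_l1_pCons [simp]: "eval_l1 (pCons c g) = scale_U1 c 1 + l1 * eval_l1 g"
  by (cases "pCons c g = 0") (auto simp: eval_l1_def fold_coeffs_pCons_not_0_0_eq
    fold_coeffs_pCons_coeff_not_0_eq)

text \<open>A Horner scheme that keeps powers of \<open>r1\<close> to the left of powers of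
  \<open>l1\<close>.\<close>

definition normal_form :: "'k::field poly poly \<Rightarrow> 'k U1" where
  "normal_form f = fold_coeffs (\<lambda>g u. eval_l1 g + r1 * u) f 0"

lemma normal_form_0 [simp]: "normal_form 0 = 0"
  by (simp add: normal_form_def)

lemma normal_form_pCons [simp]: "normal_form (pCons g f) = eval_l1 g + r1 * normal_form f"
  by (cases "pCons g f = 0") (auto simp: normal_form_def fold_coeffs_pCons_not_0_0_eq
    fold_coeffs_pCons_coeff_not_0_eq)

lemma eval_l1_add: "eval_l1 (g + h) = eval_l1 g + eval_l1 h"
  by (induction g h rule: poly_induct2) (simp_all add: algebra_simps U1.scale_left_distrib)

lemma eval_l1_smult: "eval_l1 (smult c g) = scale_U1 c (eval_l1 g)"
  by (induction g) (simp_all add: U1.scale_right_distrib scale_U1_mult_right)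

lemma normal_form_add: "normal_form (f + h) = normal_form f + normal_form h"
  by (induction f h rule: poly_induct2) (simp_all add: algebra_simps eval_l1_add)

lemma normal_form_diff: "normal_form (f - h) = normal_form f - normal_form h"
  using normal_form_add[of "f - h" h] by (simp add: algebra_simps)

lemma normal_form_smult: "normal_form (smult [:c:] f) = scale_U1 c (normal_form f)"
  by (induction f) (simp_all add: U1.scale_right_distrib scale_U1_mult_right eval_l1_smult)

text \<open>Moving \<open>l1\<close> past one factor \<open>r1\<close> costs \<open>r1^2\<close>,
  which matches the derivative term in the action of \<open>l1\<close>.\<close>

lemma normal_form_act_l1: "normal_form (act l1 f) = l1 * normal_form f"
proof (induction f)
  case (pCons g f)
  have "act l1 (pCons g f) = pCons (pCons 0 g) (act l1 f) - pCons 0 (pCons 0 f)"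
    by (simp add: act_l1 pderiv_pCons)
  moreover have "l1 * (r1 * u) = r1 * (l1 * u) - r1 * (r1 * u)" for u :: "'a U1"
    using U1_relation[where 'k='a] by (simp add: power2_eq_square flip: mult.assoc left_diff_distrib)
  ultimately show ?case
    by (simp add: normal_form_diff pCons.IH algebra_simps)
qed (simp add: act_l1)

lemma normal_form_act: "normal_form (act u f) = u * normal_form f"
proof (induction u rule: U1_induct)
  case (scalar c)
  then show ?case by (simp add: act_scale_1 normal_form_smult scale_U1_mult_left)
next
  case (r1 u)
  then show ?case by (simp add: act_mult act_r1 mult.assoc)
qed (simp_all add: act_add act_mult normal_form_act_l1 normal_form_add distrib_right mult.assoc)

definition symbol :: "'k::field U1 \<Rightarrow> 'k poly poly" where
  "symbol u = act u 1"

lemma normal_form_symbol [simp]: "normal_form (symbol u) = u"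
  by (simp add: symbol_def normal_form_act one_pCons)

text \<open>On symbols \<open>r1\<close> is multiplication by \<open>r\<close>, which is injective,
  and \<open>symbol\<close> has the left inverse \<open>normal_form\<close>.\<close>

lemma r1_mult_eq_0_iff [simp]: "r1 * u = 0 \<longleftrightarrow> u = (0 :: 'k::field U1)"
proof
  assume "r1 * u = 0"
  then have "act r1 (symbol u) = 0"
    by (simp add: symbol_def flip: act_mult)
  then have "symbol u = 0"
    by (simp add: act_r1)
  then show "u = 0"
    by (metis normal_form_0 normal_form_symbol)
qed simp

lemma r1_nonzero [simp]: "r1 \<noteq> (0 :: 'k::field U1)"
  using r1_mult_eq_0_iff[of 1] by auto

lemma r1_mult_cancel [simp]: "r1 * u = r1 * v \<longleftrightarrow> u = (v :: 'k::field U1)"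
  using r1_mult_eq_0_iff[of "u - v"] by (simp add: right_diff_distrib)

lemma U1_r1_adic_induct [case_names 0 step]:
  assumes "P 0" "\<And>g u. P u \<Longrightarrow> P (eval_l1 g + r1 * u)"
  shows "P u"
proof -
  have "P (normal_form f)" for f
    by (induction f) (simp_all add: assms)
  then show ?thesis
    by (metis normal_form_symbol)
qed

section \<open>Reduction modulo \<open>r1\<close>\<close>

text \<open>The projection of \<open>U1\<close> onto \<open>U1 / (r1) \<cong> K[l1]\<close>.\<close>

definition mod_r1 :: "'k::field U1 \<Rightarrow> 'k poly" where
  "mod_r1 u = coeff (symbol u) 0"

lemma mod_r1_add [simp]: "mod_r1 (u + v) = mod_r1 u + mod_r1 v"
  by (simp add: mod_r1_def symbol_def act_add)

lemma mod_r1_diff [simp]: "mod_r1 (u - v) = mod_r1 u - mod_r1 v"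
  using mod_r1_add[of "u - v" v] by (simp add: algebra_simps)

lemma mod_r1_0 [simp]: "mod_r1 0 = 0"
  by (simp add: mod_r1_def symbol_def)

lemma mod_r1_scale_1 [simp]: "mod_r1 (scale_U1 c 1) = [:c:]"
  by (simp add: mod_r1_def symbol_def act_scale_1)

lemma mod_r1_1 [simp]: "mod_r1 1 = 1"
  using mod_r1_scale_1[of 1] by (simp add: one_pCons)

text \<open>Modulo \<open>r\<close> the derivative term disappears, so only multiplication is left;
  this makes \<open>mod_r1\<close> a ring homomorphism.\<close>

lemma coeff_0_act: "coeff (act u f) 0 = mod_r1 u * coeff f 0"
proof (induction u rule: U1_induct)
  case (scalar c)
  then show ?case by (simp add: act_scale_1)
qed (simp_all add: act_add act_mult act_l1 act_r1 mod_r1_def symbol_def algebra_simps)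

lemma mod_r1_mult [simp]: "mod_r1 (u * v) = mod_r1 u * mod_r1 v"
  using coeff_0_act by (metis act_mult mod_r1_def symbol_def)

lemma mod_r1_l1 [simp]: "mod_r1 l1 = [:0, 1:]"
  and mod_r1_r1 [simp]: "mod_r1 r1 = 0"
  by (simp_all add: mod_r1_def symbol_def act_l1 act_r1)

lemma mod_r1_of_nat [simp]: "mod_r1 (of_nat n) = of_nat n"
  by (induction n) simp_all

lemma mod_r1_eval_l1 [simp]: "mod_r1 (eval_l1 g) = g"
  by (induction g) simp_all

lemma mod_r1_eq_0E:
  assumes "mod_r1 u = 0"
  obtains v where "u = r1 * v"
proof -
  have "mod_r1 u = 0 \<longrightarrow> (\<exists>v. u = r1 * v)"
    by (induction u rule: U1_r1_adic_induct) (auto intro: exI[of _ 0])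
  with assms that show ?thesis by blast
qed

section \<open>Commutators with the generators\<close>

lemma l1_r1: "l1 * r1 = r1 * l1 - r1 * (r1 :: 'k::field U1)"
  using U1_relation[where 'k='k] by (simp add: power2_eq_square)

lemma l1_r1_left: "l1 * (r1 * u) = r1 * (l1 * u) - r1 * (r1 * (u :: 'k::field U1))"
  by (simp add: l1_r1 algebra_simps flip: mult.assoc)

text \<open>The commutator with \<open>r1\<close> is a derivation sending \<open>l1\<close> to
  \<open>r1^2\<close> and \<open>r1\<close> to \<open>0\<close>, so its leading part is
  \<open>r1^2\<close> times d/d\<open>l1\<close>.\<close>

lemma commutator_r1:
  fixes u :: "'k::field U1"
  obtains v where "r1 * u - u * r1 = r1 * (r1 * v)" "mod_r1 v = pderiv (mod_r1 u)"
proof -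
  have "\<exists>v. r1 * u - u * r1 = r1 * (r1 * v) \<and> mod_r1 v = pderiv (mod_r1 u)"
  proof (induction u rule: U1_induct)
    case (scalar c)
    then show ?case
      by (intro exI[of _ 0]) (simp add: scale_U1_mult_left scale_U1_mult_right)
  next
    case (add u v)
    then obtain u' v' where "r1 * u - u * r1 = r1 * (r1 * u')" "mod_r1 u' = pderiv (mod_r1 u)"
      "r1 * v - v * r1 = r1 * (r1 * v')" "mod_r1 v' = pderiv (mod_r1 v)"
      by blast
    then show ?case
      by (intro exI[of _ "u' + v'"]) (simp add: algebra_simps pderiv_add)
  next
    case (l1 u)
    then obtain v where v: "u * r1 = r1 * u - r1 * (r1 * v)" "mod_r1 v = pderiv (mod_r1 u)"
      by (metis diff_diff_eq2 add_diff_cancel_left' diff_add_cancel)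
    show ?case
      \<comment> \<open>The two subtracted terms come from
        \<open>l1 * r1^2 = r1^2 * l1 - 2 * r1^3\<close>.\<close>
      by (intro exI[of _ "u + l1 * v - r1 * v - r1 * v"])
        (simp add: v mult.assoc algebra_simps l1_r1_left pderiv_mult pderiv_pCons)
  next
    case (r1 u)
    then obtain v where v: "r1 * u - u * r1 = r1 * (r1 * v)"
      by blast
    have "r1 * (r1 * u) - r1 * u * r1 = r1 * (r1 * u - u * r1)"
      by (simp add: algebra_simps)
    with v show ?case
      by (intro exI[of _ "r1 * v"]) simp
  qed
  then show ?thesis using that by blast
qed

lemma r1_normal:
  fixes u :: "'k::field U1"
  obtains v where "u * r1 = r1 * v" "mod_r1 v = mod_r1 u"
proof -
  obtain w where "r1 * u - u * r1 = r1 * (r1 * w)"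
    by (rule commutator_r1)
  then have "u * r1 = r1 * (u - r1 * w)"
    by (simp add: algebra_simps)
  with that show ?thesis by simp
qed

lemma commutator_l1:
  fixes u :: "'k::field U1"
  shows "\<exists>v. u * l1 - l1 * u = r1 * (r1 * v)"
proof (induction u rule: U1_induct)
  case (scalar c)
  then show ?case
    by (intro exI[of _ 0]) (simp add: scale_U1_mult_left scale_U1_mult_right)
next
  case (add u v)
  then obtain u' v' where "u * l1 - l1 * u = r1 * (r1 * u')" "v * l1 - l1 * v = r1 * (r1 * v')"
    by blast
  then show ?case
    by (intro exI[of _ "u' + v'"]) (simp add: algebra_simps)
next
  case (l1 u)
  then obtain v where "u * l1 - l1 * u = r1 * (r1 * v)"
    by blast
  then have "u * l1 = l1 * u + r1 * (r1 * v)"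
    by (simp add: algebra_simps)
  then show ?case
    by (intro exI[of _ "l1 * v - r1 * v - r1 * v"]) (simp add: mult.assoc algebra_simps l1_r1_left)
next
  case (r1 u)
  then obtain v where "u * l1 - l1 * u = r1 * (r1 * v)"
    by blast
  then have "u * l1 = l1 * u + r1 * (r1 * v)"
    by (simp add: algebra_simps)
  then show ?case
    by (intro exI[of _ "u + r1 * v"]) (simp add: mult.assoc algebra_simps l1_r1_left)
qed

section \<open>Absence of zero divisors\<close>

lemma mult_eq_0_mod_r1:
  assumes "mod_r1 u \<noteq> 0" "u * v = 0"
  shows "v = 0"
  using assms
proof (induction v arbitrary: u rule: U1_r1_adic_induct)
  case (step g v)
  have "mod_r1 u * g = 0"
    using arg_cong[OF step.prems(2), of mod_r1] by simp
  with step.prems have "g = 0" by simp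
  \<comment> \<open>Moving \<open>r1\<close> to the left changes \<open>u\<close> to
    \<open>u'\<close> but keeps its nonzero residue, so after cancelling \<open>r1\<close> the
    induction hypothesis applies to \<open>u'\<close>.\<close>
  obtain u' where u': "u * r1 = r1 * u'" "mod_r1 u' = mod_r1 u"
    by (rule r1_normal)
  have "r1 * (u' * v) = u * (r1 * v)"
    by (simp add: u'(1) flip: mult.assoc)
  with step.prems \<open>g = 0\<close> have "u' * v = 0" by simp
  with step.IH[of u'] step.prems u' \<open>g = 0\<close> show ?case by simp
qed simp

text \<open>Factors \<open>r1\<close> are cancelled from the left factor until its residue is
  nonzero.\<close>

instance U1 :: (field) ring_1_no_zero_divisors
proof
  fix u v :: "'a U1"
  assume "u \<noteq> 0" "v \<noteq> 0"
  then show "u * v \<noteq> 0"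
  proof (induction u rule: U1_r1_adic_induct)
    case (step g u)
    show ?case
    proof (cases "g = 0")
      case True
      with step show ?thesis by (simp add: mult.assoc)
    next
      case False
      with step.prems mult_eq_0_mod_r1[of "eval_l1 g + r1 * u" v] show ?thesis by auto
    qed
  qed simp
qed

section \<open>The centralizer of \<open>r1\<close>\<close>

lemma subalgebra_R1: "subalgebra_U1 R1"
  unfolding R1_def by (rule hull_in) (auto simp: subalgebra_U1_def intro: U1.subspace_Inter)

lemma R1_closed:
  "0 \<in> R1" "scale_U1 c 1 \<in> R1" "r1 \<in> R1"
  "u \<in> R1 \<Longrightarrow> v \<in> R1 \<Longrightarrow> u + v \<in> R1" "u \<in> R1 \<Longrightarrow> v \<in> R1 \<Longrightarrow> u * v \<in> R1"
  using subalgebra_R1 hull_inc[of r1 "{r1}" subalgebra_U1]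
  by (auto simp: subalgebra_U1_def R1_def
      intro: U1.subspace_0 U1.subspace_scale U1.subspace_add)

lemma centralizer_r1:
  fixes u :: "'k::field_char_0 U1"
  assumes "r1 * u = u * r1"
  shows "u \<in> R1"
  using assms
proof (induction u rule: U1_r1_adic_induct)
  case 0
  show ?case by (rule R1_closed)
next
  case (step g u)
  obtain v where "r1 * (eval_l1 g + r1 * u) - (eval_l1 g + r1 * u) * r1 = r1 * (r1 * v)"
    "mod_r1 v = pderiv (mod_r1 (eval_l1 g + r1 * u))"
    by (rule commutator_r1)
  \<comment> \<open>The commutator vanishes, hence so does \<open>v\<close>, whose residue is the
    derivative of \<open>g\<close>.\<close>
  with step.prems have "pderiv g = 0"
    by simp
  then obtain c where "g = [:c:]"
    by (metis pderiv_eq_0_iff degree_eq_zeroE)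
  then have g: "eval_l1 g = scale_U1 c 1"
    by simp
  have "r1 * (r1 * u) = r1 * (u * r1)"
    using step.prems by (simp add: g algebra_simps scale_U1_mult_left scale_U1_mult_right)
  then have "u \<in> R1"
    by (intro step.IH) simp
  then show ?case
    by (simp add: g R1_closed)
qed

section \<open>Nilpotency orders\<close>

text \<open>The summand at the top indices of the Leibniz rule: it shows that over a domain of
  characteristic \<open>0\<close> the nilpotency orders of the factors add up.\<close>

lemma Leibniz_top:
  fixes D :: "'a::ring_1 \<Rightarrow> 'a"
  assumes add: "\<And>x y. D (x + y) = D x + D y" and Leibniz: "\<And>x y. D (x * y) = D x * y + x * D y"
    and "(D ^^ Suc m) x = 0" "(D ^^ Suc n) y = 0"
  shows "(D ^^ (m + n)) (x * y) = of_nat ((m + n) choose m) * (D ^^ m) x * (D ^^ n) y"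
proof -
  have D_0: "D 0 = 0"
    using add[of 0 0] by simp
  then have pow_0: "(D ^^ k) 0 = 0" for k
    by (induction k) simp_all
  have pow_add: "(D ^^ k) (x + y) = (D ^^ k) x + (D ^^ k) y" for k x y
    by (induction k) (simp_all add: add)
  show ?thesis
    using assms(3,4)
  proof (induction "m + n" arbitrary: m n x y)
    case 0
    then show ?case by simp
  next
    case (Suc N)
    \<comment> \<open>One application of \<open>D\<close> lowers the bound for one factor; the two
      resulting binomials add up by Pascal's rule.\<close>
    have left: "(D ^^ N) (D x * y) = of_nat (N choose m') * (D ^^ m) x * (D ^^ n) y"
      if "m = Suc m'" for m'
      using Suc.hyps(1)[of m' n "D x" y] Suc.hyps(2) Suc.prems that
      by (simp del: funpow.simps add: funpow_Suc_right)
    have right: "(D ^^ N) (x * D y) = of_nat (N choose m) * (D ^^ m) x * (D ^^ n) y"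
      if "n = Suc n'" for n'
      using Suc.hyps(1)[of m n' x "D y"] Suc.hyps(2) Suc.prems that
      by (simp del: funpow.simps add: funpow_Suc_right)
    have split: "(D ^^ (m + n)) (x * y) = (D ^^ N) (D x * y) + (D ^^ N) (x * D y)"
      unfolding Suc.hyps(2)[symmetric] by (simp add: funpow_Suc_right Leibniz pow_add del: funpow.simps)
    show ?case
    proof (cases m; cases n)
      assume "m = 0" "n = 0"
      with Suc.hyps(2) show ?thesis by simp
    next
      fix n' assume "m = 0" "n = Suc n'"
      with split right Suc.prems show ?thesis by (simp add: pow_0)
    next
      fix m' assume "m = Suc m'" "n = 0"
      with split left Suc.prems Suc.hyps(2) show ?thesis by (simp add: pow_0)
    next
      fix m' n' assume mn: "m = Suc m'" "n = Suc n'"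
      have "(m + n) choose m = (N choose m') + (N choose m)"
        unfolding Suc.hyps(2)[symmetric] by (simp add: mn(1))
      with split left[OF mn(1)] right[OF mn(2)] show ?thesis
        by (simp add: distrib_right)
    qed
  qed
qed

lemma nilpotency_order:
  fixes x :: "'a::zero"
  assumes "locally_nilpotent D" "x \<noteq> 0"
  obtains m where "(D ^^ m) x \<noteq> 0" "(D ^^ Suc m) x = 0"
proof -
  obtain k where "(D ^^ k) x = 0"
    using assms(1) by (auto simp: locally_nilpotent_def)
  moreover have "(D ^^ 0) x \<noteq> 0"
    using assms(2) by simp
  ultimately show ?thesis
    using that ex_least_nat_less[of "\<lambda>k. (D ^^ k) x = 0" k] by auto
qed

text \<open>With orders \<open>m\<close> of \<open>x\<close> and \<open>n\<close> of
  \<open>y\<close>, \<open>D ^^ (m + n)\<close> kills \<open>D x\<close> since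
  \<open>D ^^ Suc m\<close> kills \<open>x\<close>, yet by \<open>Leibniz_top\<close> it does not
  kill \<open>x * y\<close>.\<close>

lemma locally_nilpotent_multiple_eq_0:
  fixes D :: "'a::ring_1_no_zero_divisors \<Rightarrow> 'a"
  assumes add: "\<And>x y. D (x + y) = D x + D y" and Leibniz: "\<And>x y. D (x * y) = D x * y + x * D y"
    and nilpotent: "locally_nilpotent D"
    and char_0: "\<And>n. n > 0 \<Longrightarrow> of_nat n \<noteq> (0 :: 'a)"
    and multiple: "D x = x * y"
  shows "D x = 0"
proof (rule ccontr)
  assume nonzero: "D x \<noteq> 0"
  with multiple have "x \<noteq> 0" "y \<noteq> 0"
    by auto
  obtain m where m: "(D ^^ m) x \<noteq> 0" "(D ^^ Suc m) x = 0"
    using nilpotency_order[OF nilpotent \<open>x \<noteq> 0\<close>] .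
  obtain n where n: "(D ^^ n) y \<noteq> 0" "(D ^^ Suc n) y = 0"
    using nilpotency_order[OF nilpotent \<open>y \<noteq> 0\<close>] .
  have D_0: "D 0 = 0"
    using add[of 0 0] by simp
  then have pow_0: "(D ^^ k) 0 = 0" for k
    by (induction k) simp_all
  have "(D ^^ (m + n)) (x * y) = (D ^^ n) ((D ^^ Suc m) x)"
    unfolding multiple[symmetric]
    by (metis add.commute funpow_add comp_apply funpow_Suc_right)
  also have "\<dots> = 0"
    by (simp only: m pow_0)
  finally have "of_nat ((m + n) choose m) * (D ^^ m) x * (D ^^ n) y = 0"
    using Leibniz_top[of D m x n y] add Leibniz m n by metis
  moreover have "of_nat ((m + n) choose m) \<noteq> (0 :: 'a)"
    by (rule char_0) simp
  ultimately show False
    using m n by simp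
qed

theorem theorem4:
  fixes D :: "'k::field_char_0 U1 \<Rightarrow> 'k U1"
  assumes "derivation_U1 D" and "locally_nilpotent D"
  shows "D l1 \<in> R1 \<and> D r1 = 0"
proof -
  have "Vector_Spaces.linear scale_U1 scale_U1 D"
    and Leibniz: "D (x * y) = D x * y + x * D y" for x y
    using assms(1) by (auto simp: derivation_U1_def)
  then have add: "D (x + y) = D x + D y" for x y
    by (simp add: Vector_Spaces.linear_iff)
  have relation: "r1 * l1 = l1 * r1 + r1 * (r1 :: 'k U1)"
    using U1_relation[where 'k='k] by (simp add: power2_eq_square)
  have D_relation: "D r1 * l1 + r1 * D l1 = D l1 * r1 + l1 * D r1 + (D r1 * r1 + r1 * D r1)"
    using arg_cong[OF relation, of D] by (simp add: add Leibniz)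
  obtain a where "D r1 * l1 - l1 * D r1 = r1 * (r1 * a)"
    using commutator_l1 by blast
  moreover obtain b where "r1 * D l1 - D l1 * r1 = r1 * (r1 * b)"
    by (rule commutator_r1)
  moreover obtain c where "r1 * D r1 - D r1 * r1 = r1 * (r1 * c)"
    by (rule commutator_r1)
  \<comment> \<open>Each product in \<open>D_relation\<close> is reordered at the cost of a multiple
    of \<open>r1^2\<close>; the terms in \<open>D l1\<close> cancel and \<open>2 * r1 * D r1\<close>
    remains.\<close>
  ultimately have "r1 * (D r1 + D r1) = r1 * (r1 * (a + b + c))"
    using D_relation by (simp add: algebra_simps)
  then have "D r1 + D r1 = r1 * (a + b + c)"
    by simp
  then have "mod_r1 (D r1) + mod_r1 (D r1) = 0"
    by (simp only: mod_r1_mult mod_r1_r1 mult_zero_left flip: mod_r1_add)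
  then have "mod_r1 (D r1) = 0"
    by (simp flip: mult_2)
  then obtain u where u: "D r1 = r1 * u"
    by (rule mod_r1_eq_0E)
  \<comment> \<open>Characteristic \<open>0\<close> is read off from the image under
    \<open>mod_r1\<close> in the polynomial ring.\<close>
  have "of_nat n \<noteq> (0 :: 'k U1)" if "n > 0" for n
  proof
    assume "of_nat n = (0 :: 'k U1)"
    then have "of_nat n = (0 :: 'k poly)"
      by (metis mod_r1_0 mod_r1_of_nat)
    with that show False by simp
  qed
  with u have D_r1: "D r1 = 0"
    using locally_nilpotent_multiple_eq_0[of D r1 u] add Leibniz assms(2) by blast
  with D_relation have "r1 * D l1 = D l1 * r1"
    by simp
  with D_r1 show ?thesis
    by (simp add: centralizer_r1)
qed

end
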